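(* Let $n_u\ge 1$, let $\mu_1,\dots,\mu_{n_u}\ge 1$ be integers and $n=\sum_{i=1}^{n_u}\mu_i$. Let $A_b=\operatorname{blkdiag}(A_1,\dots,A_{n_u})\in\mathbb{R}^{n\times n}$ and $B_b=\operatorname{blkdiag}(B_1,\dots,B_{n_u})\in\mathbb{R}^{n\times n_u}$ be the Brunovsky pair with indices $\mu_1,\dots,\mu_{n_u}$. Let $P\in\mathbb{R}^{n\times n}$ be a symmetric (cost-to-go) matrix, viewed as an $n_u\times n_u$ block matrix with blocks $P_{ij}=[P]_{i,j}\in\mathbb{R}^{\mu_i\times\mu_j}$. Then for every choice of $X,Y\in\{A,B\}$ and all $1\le i,j\le n_u$, $$[X_b^\top P\,Y_b]_{i,j}=X_i^\top P_{ij}Y_j ,$$ where $[X_b^\top P Y_b]_{i,j}$ denotes the $(i,j)$ block of $X_b^\top PY_b$. Moreover, for all $1\le i,j\le n_u$, $1\le m\le\mu_i$, $1\le l\le\mu_j$, the entries of these blocks are: $$[A_i^\top P_{ij}A_j]_{m,l}=[P_{ij}]_{m-1,l-1}\ \text{ if } m,l\ge 2,\qquad [A_i^\top P_{ij}A_j]_{m,l}=0\ \text{ if } m=1 \text{ or } l=1,$$ $$[B_i^\top P_{ij}A_j]_{1,l}=[P_{ij}]_{\mu_i,\,l-1}\ \text{ if } l\ge 2,\qquad [B_i^\top P_{ij}A_j]_{1,1}=0,$$ $$B_i^\top P_{ij}B_j=[P_{ij}]_{\mu_i,\mu_j}.$$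
   Context: The Brunovsky pair with controllability indices $\mu_1,\dots,\mu_{n_u}$ is $A_b=\operatorname{blkdiag}(A_1,\dots,A_{n_u})$, $B_b=\operatorname{blkdiag}(B_1,\dots,B_{n_u})$ with $$A_i=\begin{bmatrix}0_{(\mu_i-1)\times 1} & I_{\mu_i-1}\\ 0 & 0_{1\times(\mu_i-1)}\end{bmatrix}\in\mathbb{R}^{\mu_i\times\mu_i},\qquad B_i=\begin{bmatrix}0_{(\mu_i-1)\times 1}\\ 1\end{bmatrix}\in\mathbb{R}^{\mu_i\times 1}$$ (so $A_i=0$, $B_i=1$ when $\mu_i=1$). $\operatorname{blkdiag}$ denotes the block diagonal matrix. The rows and columns of $A_b$ and $P$, and the rows of $B_b$, are partitioned according to $(\mu_1,\dots,\mu_{n_u})$; the columns of $B_b$ are partitioned into $n_u$ blocks of width $1$. $[M]_{i,j}$ denotes a block of a block matrix or a scalar entry of a matrix, as indicated. *)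

theory Defs
  imports Complex_Main "Jordan_Normal_Form.Matrix" "Jordan_Normal_Form.DL_Submatrix"
begin

definition chain_A :: "nat \<Rightarrow> real mat" where
  "chain_A m = four_block_mat
     (0\<^sub>m (m - 1) 1) (1\<^sub>m (m - 1))
     (0\<^sub>m 1 1)       (0\<^sub>m 1 (m - 1))"

definition chain_B :: "nat \<Rightarrow> real mat" where
  "chain_B m = 0\<^sub>m (m - 1) 1 @\<^sub>r 1\<^sub>m 1"

definition brunovsky_A :: "nat list \<Rightarrow> real mat" where
  "brunovsky_A mu = diag_block_mat (map chain_A mu)"

definition brunovsky_B :: "nat list \<Rightarrow> real mat" where
  "brunovsky_B mu = diag_block_mat (map chain_B mu)"

text \<open>The lists \<open>rs\<close> and \<open>cs\<close> are the successive block heights and widths of the partition of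
  \<open>M\<close>. Block indices count from 0, as do the entries of the type \<open>mat\<close>.\<close>

definition block_range :: "nat list \<Rightarrow> nat \<Rightarrow> nat set" where
  "block_range ds i = {sum_list (take i ds)..<sum_list (take (Suc i) ds)}"

definition mat_block :: "nat list \<Rightarrow> nat list \<Rightarrow> 'a mat \<Rightarrow> nat \<Rightarrow> nat \<Rightarrow> 'a mat" where
  "mat_block rs cs M i j = submatrix M (block_range rs i) (block_range cs j)"

lemma chain_A_carrier: "m \<ge> 1 \<Longrightarrow> chain_A m \<in> carrier_mat m m"
  by (auto simp: chain_A_def)

lemma chain_B_carrier: "m \<ge> 1 \<Longrightarrow> chain_B m \<in> carrier_mat m 1"
  by (auto simp: chain_B_def append_rows_def)

lemma chain_A_index:
  "p < m \<Longrightarrow> q < m \<Longrightarrow> chain_A m $$ (p, q) = (if q = Suc p then 1 else 0)"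
  by (auto simp: chain_A_def)

lemma chain_B_index:
  "p < m \<Longrightarrow> chain_B m $$ (p, 0) = (if Suc p = m then 1 else 0)"
  by (auto simp: chain_B_def append_rows_def)

lemma block_range_bounded:
  assumes "i < length ds" "k \<in> block_range ds i"
  shows "k < sum_list ds"
proof -
  have "sum_list ds = sum_list (take (Suc i) ds) + sum_list (drop (Suc i) ds)"
    by (metis append_take_drop_id sum_list_append)
  with assms(2) show ?thesis by (simp add: block_range_def)
qed

lemma card_block_range: "i < length ds \<Longrightarrow> card (block_range ds i) = ds ! i"
  by (simp add: block_range_def take_Suc_conv_app_nth)

lemma pick_atLeastLessThan: "a + k < b \<Longrightarrow> pick {a..<b} k = a + k"
proof (induction k)
  case 0
  show ?case unfolding pick.simps
    by (rule Least_equality) (use "0.prems" in simp_all)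
next
  case (Suc k)
  then have IH: "pick {a..<b} k = a + k" by simp
  show ?case unfolding pick.simps IH
    by (rule Least_equality) (use Suc.prems in simp_all)
qed

lemma mat_block_carrier:
  assumes "M \<in> carrier_mat (sum_list rs) (sum_list cs)" "i < length rs" "j < length cs"
  shows "mat_block rs cs M i j \<in> carrier_mat (rs ! i) (cs ! j)"
proof -
  have eq: "{k. k < sum_list ds \<and> k \<in> block_range ds l} = block_range ds l" if "l < length ds" for ds l
    using block_range_bounded[OF that] by blast
  have "dim_row M = sum_list rs" "dim_col M = sum_list cs"
    using assms(1) by simp_all
  then show ?thesis
    unfolding mat_block_def
    by (intro carrier_matI)
      (simp_all only: dim_submatrix eq[OF assms(2)] eq[OF assms(3)]
        card_block_range[OF assms(2)] card_block_range[OF assms(3)])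
qed

lemma mat_block_index:
  assumes "M \<in> carrier_mat (sum_list rs) (sum_list cs)" "i < length rs" "j < length cs"
    and "p < rs ! i" "q < cs ! j"
  shows "mat_block rs cs M i j $$ (p, q)
    = M $$ (sum_list (take i rs) + p, sum_list (take j cs) + q)"
proof -
  have d: "dim_row (mat_block rs cs M i j) = rs ! i" "dim_col (mat_block rs cs M i j) = cs ! j"
    using mat_block_carrier[OF assms(1-3)] by auto
  then have "mat_block rs cs M i j $$ (p, q)
      = M $$ (pick (block_range rs i) p, pick (block_range cs j) q)"
    unfolding mat_block_def dim_submatrix using assms(4,5) by (simp add: submatrix_index)
  also have "pick (block_range rs i) p = sum_list (take i rs) + p"
    unfolding block_range_def using assms(2,4) by (intro pick_atLeastLessThan) (simp add: take_Suc_conv_app_nth)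
  also have "pick (block_range cs j) q = sum_list (take j cs) + q"
    unfolding block_range_def using assms(3,5) by (intro pick_atLeastLessThan) (simp add: take_Suc_conv_app_nth)
  finally show ?thesis .
qed

end

theory Submission
  imports Defs
begin

text \<open>A block diagonal matrix vanishes outside its diagonal blocks. Column \<open>q\<close> of the \<open>j\<close>-th
  column block of \<open>diag_block_mat Xs\<close> is therefore supported in the \<open>j\<close>-th row block, where it is
  column \<open>q\<close> of \<open>Xs ! j\<close>
  (\<open>index_diag_block_mat_column\<close>). In an entry of \<open>X\<^sup>T * P * Y\<close>, written as a double sum, the
  two summation ranges thus shrink to one block each, and what remains is the corresponding entry of
  the product of the small matrices (\<open>mat_block_diag_sandwich\<close>). This holds for arbitrary
  rectangular diagonal blocks, and the block formula of the theorem is the special case where these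
  are the Brunovsky blocks.

  The entry formulas express how the Brunovsky blocks act by multiplication from the right: the chain
  matrix moves every column one place to the right and clears the first one, while the input
  column picks out the last column (\<open>index_mult_chain_A\<close>, \<open>index_mult_chain_B\<close>).
  Transposition gives the same action on rows from the left.\<close>

section \<open>Columns of block diagonal matrices\<close>

lemma index_diag_block_mat_column:
  assumes "j < length Ms" and "r < sum_list (map dim_row Ms)" and "q < dim_col (Ms ! j)"
  shows "diag_block_mat Ms $$ (r, sum_list (take j (map dim_col Ms)) + q)
    = (if r \<in> block_range (map dim_row Ms) j
       then Ms ! j $$ (r - sum_list (take j (map dim_row Ms)), q) else 0)"
  using assms
proof (induction Ms arbitrary: j r)
  case Nil
  then show ?case by simp
next
  case (Cons M Ms)
  show ?case
  proof (cases j)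
    case 0
    with Cons.prems show ?thesis
      by (auto simp: Let_def dim_diag_block_mat block_range_def)
  next
    case (Suc j')
    \<comment> \<open>The column lies inside the tail matrix, as the index rules of \<open>four_block_mat\<close> require.\<close>
    have c: "sum_list (take j' (map dim_col Ms)) + q < sum_list (map dim_col Ms)"
      by (rule block_range_bounded[of j'])
        (use Cons.prems Suc in \<open>auto simp: block_range_def take_Suc_conv_app_nth\<close>)
    show ?thesis
    proof (cases "r < dim_row M")
      case True
      with Suc c Cons.prems show ?thesis
        by (simp add: Let_def dim_diag_block_mat block_range_def)
    next
      case False
      then obtain r' where r: "r = dim_row M + r'"
        by (metis le_iff_add not_less)
      with Cons.prems Suc have "r' < sum_list (map dim_row Ms)" "j' < length Ms"
        "q < dim_col (Ms ! j')" by simp_all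
      from Cons.IH[OF this(2,1,3)] show ?thesis
        using Suc c Cons.prems r by (simp add: Let_def dim_diag_block_mat block_range_def)
    qed
  qed
qed

text \<open>The form in which the support of such a column enters a sum over all rows.\<close>

lemma sum_block_range:
  fixes f :: "nat \<Rightarrow> 'a::comm_monoid_add"
  assumes "j < length ds"
  shows "(\<Sum>r<sum_list ds. if r \<in> block_range ds j then f r else 0)
    = (\<Sum>p<ds ! j. f (sum_list (take j ds) + p))"
proof -
  have "(\<Sum>r<sum_list ds. if r \<in> block_range ds j then f r else 0) = sum f ({..<sum_list ds} \<inter> block_range ds j)"
    by (simp add: sum.inter_restrict)
  also have "{..<sum_list ds} \<inter> block_range ds j
      = {sum_list (take j ds)..<sum_list (take j ds) + ds ! j}"
    using assms block_range_bounded[OF assms]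
    by (auto simp: block_range_def take_Suc_conv_app_nth)
  also have "sum f \<dots> = (\<Sum>p<ds ! j. f (sum_list (take j ds) + p))"
    by (simp add: sum.atLeastLessThan_shift_0[of f] lessThan_atLeast0 comp_def)
  finally show ?thesis .
qed

section \<open>Congruence by block diagonal matrices\<close>

lemma index_transpose_mult_mult:
  fixes X P Y :: "'a::semiring_0 mat"
  assumes "P \<in> carrier_mat (dim_row X) (dim_row Y)" and "p < dim_col X" and "q < dim_col Y"
  shows "(X\<^sup>T * P * Y) $$ (p, q)
    = (\<Sum>s<dim_row Y. (\<Sum>r<dim_row X. X $$ (r, p) * P $$ (r, s)) * Y $$ (s, q))"
proof -
  have "(X\<^sup>T * P * Y) $$ (p, q) = (\<Sum>s<dim_row Y. (X\<^sup>T * P) $$ (p, s) * Y $$ (s, q))"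
    using assms by (simp add: index_mult_mat(1)[of p "X\<^sup>T * P" q Y] scalar_prod_def lessThan_atLeast0 del: index_mult_mat(1))
  also have "\<dots> = (\<Sum>s<dim_row Y. (\<Sum>r<dim_row X. X $$ (r, p) * P $$ (r, s)) * Y $$ (s, q))"
    using assms by (intro sum.cong) (auto simp: scalar_prod_def lessThan_atLeast0)
  finally show ?thesis .
qed

text \<open>Restricting both sums of the previous lemma to the supports of the two columns leaves the same
  double sum for one pair of diagonal blocks.\<close>

lemma mat_block_diag_sandwich:
  fixes P :: "'a::semiring_0 mat"
  assumes P: "P \<in> carrier_mat (sum_list (map dim_row Xs)) (sum_list (map dim_row Ys))"
    and i: "i < length Xs" and j: "j < length Ys"
  shows "mat_block (map dim_col Xs) (map dim_col Ys)
      ((diag_block_mat Xs)\<^sup>T * P * diag_block_mat Ys) i j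
    = (Xs ! i)\<^sup>T * mat_block (map dim_row Xs) (map dim_row Ys) P i j * Ys ! j"
    (is "mat_block ?cX ?cY ?S i j = _ * ?Q * _")
proof -
  let ?D = "diag_block_mat Xs" and ?E = "diag_block_mat Ys"
  let ?rX = "map dim_row Xs" and ?rY = "map dim_row Ys"
  have S: "?S \<in> carrier_mat (sum_list ?cX) (sum_list ?cY)"
    by (intro carrier_matI) (simp_all add: dim_diag_block_mat)
  have Q: "?Q \<in> carrier_mat (dim_row (Xs ! i)) (dim_row (Ys ! j))"
    using mat_block_carrier[OF P, of i j] i j by simp
  have B: "mat_block ?cX ?cY ?S i j \<in> carrier_mat (dim_col (Xs ! i)) (dim_col (Ys ! j))"
    using mat_block_carrier[OF S, of i j] i j by simp
  show ?thesis
  proof (rule eq_matI)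
    fix p q
    assume "p < dim_row ((Xs ! i)\<^sup>T * ?Q * Ys ! j)" "q < dim_col ((Xs ! i)\<^sup>T * ?Q * Ys ! j)"
    then have p: "p < dim_col (Xs ! i)" and q: "q < dim_col (Ys ! j)" by simp_all
    let ?p = "sum_list (take i ?cX) + p" and ?q = "sum_list (take j ?cY) + q"
    have p': "?p < sum_list ?cX"
      by (rule block_range_bounded[of i])
        (use i p in \<open>auto simp: block_range_def take_Suc_conv_app_nth\<close>)
    have q': "?q < sum_list ?cY"
      by (rule block_range_bounded[of j])
        (use j q in \<open>auto simp: block_range_def take_Suc_conv_app_nth\<close>)
    \<comment> \<open>The inner sum depends on the column \<open>s\<close> of \<open>P\<close>, so it is restricted for every \<open>s\<close>, before the
      outer sum.\<close>
    have row_sum: "(\<Sum>r<sum_list ?rX. ?D $$ (r, ?p) * P $$ (r, s))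
        = (\<Sum>a<dim_row (Xs ! i). Xs ! i $$ (a, p) * P $$ (sum_list (take i ?rX) + a, s))" for s
    proof -
      have "(\<Sum>r<sum_list ?rX. ?D $$ (r, ?p) * P $$ (r, s))
          = (\<Sum>r<sum_list ?rX. if r \<in> block_range ?rX i
               then Xs ! i $$ (r - sum_list (take i ?rX), p) * P $$ (r, s) else 0)"
        by (rule sum.cong) (simp_all add: index_diag_block_mat_column[OF i _ p])
      then show ?thesis
        using i by (simp add: sum_block_range)
    qed
    have "mat_block ?cX ?cY ?S i j $$ (p, q) = ?S $$ (?p, ?q)"
      using mat_block_index[OF S, of i j p q] i j p q by simp
    also have "\<dots> = (\<Sum>s<sum_list ?rY. (\<Sum>r<sum_list ?rX. ?D $$ (r, ?p) * P $$ (r, s)) * ?E $$ (s, ?q))"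
      using index_transpose_mult_mult[of P ?D ?E ?p ?q] P p' q' by (simp add: dim_diag_block_mat)
    also have "\<dots> = (\<Sum>s<sum_list ?rY. if s \<in> block_range ?rY j
        then (\<Sum>a<dim_row (Xs ! i). Xs ! i $$ (a, p) * P $$ (sum_list (take i ?rX) + a, s))
          * Ys ! j $$ (s - sum_list (take j ?rY), q) else 0)"
      by (rule sum.cong) (simp_all add: row_sum index_diag_block_mat_column[OF j _ q])
    also have "\<dots> = (\<Sum>b<dim_row (Ys ! j). (\<Sum>a<dim_row (Xs ! i). Xs ! i $$ (a, p)
        * P $$ (sum_list (take i ?rX) + a, sum_list (take j ?rY) + b)) * Ys ! j $$ (b, q))"
      using j by (simp add: sum_block_range)
    also have "\<dots> = (\<Sum>b<dim_row (Ys ! j). (\<Sum>a<dim_row (Xs ! i). Xs ! i $$ (a, p)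
        * ?Q $$ (a, b)) * Ys ! j $$ (b, q))"
      using i j by (simp add: mat_block_index[OF P])
    also have "\<dots> = ((Xs ! i)\<^sup>T * ?Q * Ys ! j) $$ (p, q)"
      using index_transpose_mult_mult[OF Q p q] by simp
    finally show "mat_block ?cX ?cY ?S i j $$ (p, q) = ((Xs ! i)\<^sup>T * ?Q * Ys ! j) $$ (p, q)" .
  qed (use B in auto)
qed

section \<open>Multiplication by the Brunovsky blocks\<close>

lemma index_mult_chain_A:
  assumes "M \<in> carrier_mat k m" and "p < k" and "q < m"
  shows "(M * chain_A m) $$ (p, q) = (if q = 0 then 0 else M $$ (p, q - 1))"
proof -
  have A: "chain_A m \<in> carrier_mat m m" using assms(3) by (intro chain_A_carrier) simp
  then have "(M * chain_A m) $$ (p, q) = (\<Sum>s<m. M $$ (p, s) * chain_A m $$ (s, q))"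
    using assms by (simp add: scalar_prod_def lessThan_atLeast0)
  also have "\<dots> = (\<Sum>s<m. if s = q - 1 then (if q = 0 then 0 else M $$ (p, s)) else 0)"
    by (rule sum.cong) (use assms(3) in \<open>auto simp: chain_A_index\<close>)
  also have "\<dots> = (if q = 0 then 0 else M $$ (p, q - 1))"
    using assms(3) by auto
  finally show ?thesis .
qed

lemma index_mult_chain_B:
  assumes "M \<in> carrier_mat k m" and "p < k" and "m \<ge> 1"
  shows "(M * chain_B m) $$ (p, 0) = M $$ (p, m - 1)"
proof -
  have "(M * chain_B m) $$ (p, 0) = (\<Sum>s<m. M $$ (p, s) * chain_B m $$ (s, 0))"
    using assms chain_B_carrier[OF assms(3)] by (simp add: scalar_prod_def lessThan_atLeast0)
  also have "\<dots> = (\<Sum>s<m. if s = m - 1 then M $$ (p, s) else 0)"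
    by (rule sum.cong) (use assms(3) in \<open>auto simp: chain_B_index\<close>)
  also have "\<dots> = M $$ (p, m - 1)"
    using assms(3) by simp
  finally show ?thesis .
qed

text \<open>Turns the column formulas above into row formulas for multiplication from the left; over a
  commutative semiring \<open>X\<^sup>T * M\<close> is the transpose of \<open>M\<^sup>T * X\<close>.\<close>

lemma index_transpose_mult_swap:
  fixes X M :: "'a::comm_semiring_0 mat"
  assumes "X \<in> carrier_mat m c" and "M \<in> carrier_mat m k" and "p < c" and "q < k"
  shows "(X\<^sup>T * M) $$ (p, q) = (M\<^sup>T * X) $$ (q, p)"
  using assms by (simp add: comm_scalar_prod[of "col X p" m])

lemma index_transpose_chain_A_mult:
  assumes "M \<in> carrier_mat m k" and "p < m" and "q < k"
  shows "((chain_A m)\<^sup>T * M) $$ (p, q) = (if p = 0 then 0 else M $$ (p - 1, q))"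
proof -
  have "chain_A m \<in> carrier_mat m m" using assms(2) by (intro chain_A_carrier) simp
  then have "((chain_A m)\<^sup>T * M) $$ (p, q) = (M\<^sup>T * chain_A m) $$ (q, p)"
    using assms by (rule index_transpose_mult_swap)
  then show ?thesis
    using assms index_mult_chain_A[of "M\<^sup>T" k m q p] by simp
qed

lemma index_transpose_chain_B_mult:
  assumes "M \<in> carrier_mat m k" and "q < k" and "m \<ge> 1"
  shows "((chain_B m)\<^sup>T * M) $$ (0, q) = M $$ (m - 1, q)"
proof -
  have "((chain_B m)\<^sup>T * M) $$ (0, q) = (M\<^sup>T * chain_B m) $$ (q, 0)"
    using index_transpose_mult_swap[OF chain_B_carrier[OF assms(3)] assms(1) _ assms(2)] by simp
  then show ?thesis
    using assms index_mult_chain_B[of "M\<^sup>T" k m q] by simp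
qed

theorem theorem1:
  fixes nu n :: nat and mu :: "nat list" and P :: "real mat"
  assumes "nu \<ge> 1"
    and "length mu = nu"
    and "\<forall>i<nu. mu ! i \<ge> 1"
    and "n = (\<Sum>i<nu. mu ! i)"
    and "P \<in> carrier_mat n n"
    and "P\<^sup>T = P"
  shows "(\<forall>(X, Xb, colsX) \<in> {(chain_A, brunovsky_A mu, mu), (chain_B, brunovsky_B mu, replicate nu 1)}.
          \<forall>(Y, Yb, colsY) \<in> {(chain_A, brunovsky_A mu, mu), (chain_B, brunovsky_B mu, replicate nu 1)}.
          \<forall>i<nu. \<forall>j<nu.
            mat_block colsX colsY (Xb\<^sup>T * P * Yb) i j
              = (X (mu ! i))\<^sup>T * mat_block mu mu P i j * Y (mu ! j))
    \<and> (\<forall>i<nu. \<forall>j<nu.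
        let A\<^sub>i = chain_A (mu ! i); A\<^sub>j = chain_A (mu ! j);
            B\<^sub>i = chain_B (mu ! i); B\<^sub>j = chain_B (mu ! j);
            P\<^sub>i\<^sub>j = mat_block mu mu P i j
        in (\<forall>m < mu ! i. \<forall>l < mu ! j.
              (m \<ge> 1 \<and> l \<ge> 1 \<longrightarrow> (A\<^sub>i\<^sup>T * P\<^sub>i\<^sub>j * A\<^sub>j) $$ (m, l) = P\<^sub>i\<^sub>j $$ (m - 1, l - 1))
            \<and> (m = 0 \<or> l = 0 \<longrightarrow> (A\<^sub>i\<^sup>T * P\<^sub>i\<^sub>j * A\<^sub>j) $$ (m, l) = 0))
         \<and> (\<forall>l < mu ! j. l \<ge> 1 \<longrightarrow> (B\<^sub>i\<^sup>T * P\<^sub>i\<^sub>j * A\<^sub>j) $$ (0, l) = P\<^sub>i\<^sub>j $$ (mu ! i - 1, l - 1))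
         \<and> (B\<^sub>i\<^sup>T * P\<^sub>i\<^sub>j * A\<^sub>j) $$ (0, 0) = 0
         \<and> B\<^sub>i\<^sup>T * P\<^sub>i\<^sub>j * B\<^sub>j = mat 1 1 (\<lambda>_. P\<^sub>i\<^sub>j $$ (mu ! i - 1, mu ! j - 1)))"
proof (intro conjI)
  have pos: "\<forall>x\<in>set mu. x \<ge> 1"
    using assms(2,3) by (auto simp: in_set_conv_nth)
  have n: "n = sum_list mu"
    using assms(2,4) by (simp add: sum_list_sum_nth lessThan_atLeast0)
  \<comment> \<open>Positivity matters here: \<open>chain_A 0\<close> is a \<open>1 \<times> 1\<close> matrix, and so is \<open>chain_B 0\<close>.\<close>
  have dims: "map dim_row (map chain_A mu) = mu" "map dim_col (map chain_A mu) = mu"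
    "map dim_row (map chain_B mu) = mu" "map dim_col (map chain_B mu) = replicate nu 1"
    using pos assms(2) carrier_matD[OF chain_A_carrier] carrier_matD[OF chain_B_carrier]
    by (auto simp: list_eq_iff_nth_eq)
  have P: "P \<in> carrier_mat (sum_list mu) (sum_list mu)"
    using assms(5) n by simp
  have block: "mat_block (map dim_col (map X mu)) (map dim_col (map Y mu))
      ((diag_block_mat (map X mu))\<^sup>T * P * diag_block_mat (map Y mu)) i j
      = (X (mu ! i))\<^sup>T * mat_block mu mu P i j * Y (mu ! j)"
    if "map dim_row (map X mu) = mu" "map dim_row (map Y mu) = mu" "i < nu" "j < nu" for X Y i j
    using mat_block_diag_sandwich[of P "map X mu" "map Y mu" i j] P that assms(2)
    by (simp del: map_map)
  show "\<forall>(X, Xb, colsX) \<in> {(chain_A, brunovsky_A mu, mu), (chain_B, brunovsky_B mu, replicate nu 1)}.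
          \<forall>(Y, Yb, colsY) \<in> {(chain_A, brunovsky_A mu, mu), (chain_B, brunovsky_B mu, replicate nu 1)}.
          \<forall>i<nu. \<forall>j<nu.
            mat_block colsX colsY (Xb\<^sup>T * P * Yb) i j
              = (X (mu ! i))\<^sup>T * mat_block mu mu P i j * Y (mu ! j)"
    using block[of chain_A chain_A] block[of chain_A chain_B]
      block[of chain_B chain_A] block[of chain_B chain_B]
    by (simp only: dims brunovsky_A_def brunovsky_B_def ball_simps prod.case simp_thms) blast
  have entries: "(\<forall>m < mu ! i. \<forall>l < mu ! j.
        (m \<ge> 1 \<and> l \<ge> 1 \<longrightarrow> ((chain_A (mu ! i))\<^sup>T * Q * chain_A (mu ! j)) $$ (m, l) = Q $$ (m - 1, l - 1))
      \<and> (m = 0 \<or> l = 0 \<longrightarrow> ((chain_A (mu ! i))\<^sup>T * Q * chain_A (mu ! j)) $$ (m, l) = 0))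
    \<and> (\<forall>l < mu ! j. l \<ge> 1 \<longrightarrow>
        ((chain_B (mu ! i))\<^sup>T * Q * chain_A (mu ! j)) $$ (0, l) = Q $$ (mu ! i - 1, l - 1))
    \<and> ((chain_B (mu ! i))\<^sup>T * Q * chain_A (mu ! j)) $$ (0, 0) = 0
    \<and> (chain_B (mu ! i))\<^sup>T * Q * chain_B (mu ! j)
      = mat 1 1 (\<lambda>_. Q $$ (mu ! i - 1, mu ! j - 1))"
    if ij: "i < nu" "j < nu" and Q_def: "Q = mat_block mu mu P i j" for i j Q
  proof -
    have mi: "mu ! i \<ge> 1" and mj: "mu ! j \<ge> 1" using assms(3) ij by auto
    have Q: "Q \<in> carrier_mat (mu ! i) (mu ! j)"
      unfolding Q_def using mat_block_carrier[OF P] ij assms(2) by simp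
    have AQ: "(chain_A (mu ! i))\<^sup>T * Q \<in> carrier_mat (mu ! i) (mu ! j)"
      and BQ: "(chain_B (mu ! i))\<^sup>T * Q \<in> carrier_mat 1 (mu ! j)"
      using Q chain_A_carrier[OF mi] chain_B_carrier[OF mi] by auto
    have "(chain_B (mu ! i))\<^sup>T * Q * chain_B (mu ! j)
        = mat 1 1 (\<lambda>_. Q $$ (mu ! i - 1, mu ! j - 1))"
      using chain_B_carrier[OF mi] chain_B_carrier[OF mj] index_mult_chain_B[OF BQ _ mj]
        index_transpose_chain_B_mult[OF Q _ mi] mj
      by (intro eq_matI) auto
    moreover have "\<forall>l < mu ! j. ((chain_B (mu ! i))\<^sup>T * Q * chain_A (mu ! j)) $$ (0, l)
        = (if l = 0 then 0 else Q $$ (mu ! i - 1, l - 1))"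
      by (simp add: index_mult_chain_A[OF BQ] index_transpose_chain_B_mult[OF Q _ mi] del: index_mult_mat)
    moreover have "\<forall>m < mu ! i. \<forall>l < mu ! j. ((chain_A (mu ! i))\<^sup>T * Q * chain_A (mu ! j)) $$ (m, l)
        = (if m = 0 \<or> l = 0 then 0 else Q $$ (m - 1, l - 1))"
      by (simp add: index_mult_chain_A[OF AQ] index_transpose_chain_A_mult[OF Q] del: index_mult_mat)
    ultimately show ?thesis
      using mi mj by simp
  qed
  show "\<forall>i<nu. \<forall>j<nu.
        let A\<^sub>i = chain_A (mu ! i); A\<^sub>j = chain_A (mu ! j);
            B\<^sub>i = chain_B (mu ! i); B\<^sub>j = chain_B (mu ! j);
            P\<^sub>i\<^sub>j = mat_block mu mu P i j
        in (\<forall>m < mu ! i. \<forall>l < mu ! j.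
              (m \<ge> 1 \<and> l \<ge> 1 \<longrightarrow> (A\<^sub>i\<^sup>T * P\<^sub>i\<^sub>j * A\<^sub>j) $$ (m, l) = P\<^sub>i\<^sub>j $$ (m - 1, l - 1))
            \<and> (m = 0 \<or> l = 0 \<longrightarrow> (A\<^sub>i\<^sup>T * P\<^sub>i\<^sub>j * A\<^sub>j) $$ (m, l) = 0))
         \<and> (\<forall>l < mu ! j. l \<ge> 1 \<longrightarrow> (B\<^sub>i\<^sup>T * P\<^sub>i\<^sub>j * A\<^sub>j) $$ (0, l) = P\<^sub>i\<^sub>j $$ (mu ! i - 1, l - 1))
         \<and> (B\<^sub>i\<^sup>T * P\<^sub>i\<^sub>j * A\<^sub>j) $$ (0, 0) = 0
         \<and> B\<^sub>i\<^sup>T * P\<^sub>i\<^sub>j * B\<^sub>j = mat 1 1 (\<lambda>_. P\<^sub>i\<^sub>j $$ (mu ! i - 1, mu ! j - 1))"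
    unfolding Let_def using entries[OF _ _ refl] by (intro allI impI)
qed

end
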